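(* Let $\mathbf p\in\mathbb P(\mathcal X)$, and let $\mathbf w^\dagger_\alpha$, $w^*_\alpha$, $\alpha_k$, $\mathcal U_k$ be the optimal weights, minimal weight, merging points and merged sets defined in the context, for the pay-off $\mathbb L_\alpha(\mathbf l,\mathbf p)$ and real-valued prefix codes. For every $k\in\{0,1,\dots,|\mathcal X|-1\}$ and every $\alpha\in[\alpha_k,\alpha_{k+1})$, the optimal weights are $$w^\dagger_\alpha(x)=\begin{cases}(1-\alpha)\,p(x), & x\in\mathcal U_k^c,\\[4pt] w^*_{\alpha_k}+(\alpha-\alpha_k)\,\dfrac{\sum_{y\in\mathcal U_k^c}p(y)}{|\mathcal U_k|}, & x\in\mathcal U_k,\end{cases}$$ and (for $k\le|\mathcal X|-2$, so that the symbols involved exist) $$\alpha_{k+1}=\alpha_k+(1-\alpha_k)\,\frac{p(x_{|\mathcal X|-(k+1)})-p(x_{|\mathcal X|-k})}{\dfrac{\sum_{y\in\mathcal U_k^c}p(y)}{|\mathcal U_k|}+p(x_{|\mathcal X|-(k+1)})}.$$ Moreover, the minimum $\alpha$, called $\alpha_{\max}$, such that for $\alpha\in[\alpha_{\max},1]$ there is no compression (i.e. all optimal weights $w^\dagger_\alpha(x)$, $x\in\mathcal X$, are equal) is $$\alpha_{\max}=1-\frac{1}{|\mathcal X|\,p(x_1)}.$$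
   Context: Let $D\ge 2$ be an integer and $\log=\log_D$. Let $\mathcal X=\{x_1,\dots,x_{|\mathcal X|}\}$ be a finite alphabet and let $\mathbb P(\mathcal X)$ be the set of probability vectors $\mathbf p=(p(x_1),\dots,p(x_{|\mathcal X|}))$ with $p(x_1)\ge p(x_2)\ge\dots\ge p(x_{|\mathcal X|})>0$ and $\sum_x p(x)=1$ (the entries need not be distinct). Real-valued prefix code length vectors are the elements of $\mathcal L(\mathbb R_+^{|\mathcal X|})=\{\mathbf l\in\mathbb R_+^{|\mathcal X|}:\sum_{x\in\mathcal X}D^{-l(x)}\le 1\}$, where $\mathbb R_+=[0,\infty)$. For $\alpha\in[0,1]$ the pay-off is $\mathbb L_\alpha(\mathbf l,\mathbf p)=\alpha\max_{x\in\mathcal X}l(x)+(1-\alpha)\sum_{x\in\mathcal X}l(x)p(x)$. For each $\alpha\in[0,1]$ let $\mathbf l^\dagger_\alpha$ be the minimizer of $\mathbb L_\alpha(\cdot,\mathbf p)$ over $\mathcal L(\mathbb R_+^{|\mathcal X|})$. The optimal weights are $w^\dagger_\alpha(x)=w_\alpha(x)=D^{-l^\dagger_\alpha(x)}$, and $w^*_\alpha=\min_{x\in\mathcal X}w_\alpha(x)$. The merging points are $\alpha_0=0$ and, for $k\in\{1,\dots,|\mathcal X|-1\}$, $$\alpha_k=\min\{\alpha\in[0,1):\ w_\alpha(x_{|\mathcal X|-(k-1)})=w_\alpha(x_{|\mathcal X|-k})\},$$ with the convention $\alpha_{|\mathcal X|}=1$. The merged sets are $\mathcal U_k=\{x\in\{x_{|\mathcal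 X|-k},\dots,x_{|\mathcal X|}\}:\ w_{\alpha_k}(x)=w^*_{\alpha_k}\}$ and $\mathcal U_k^c=\mathcal X\setminus\mathcal U_k$. Empty sums are $0$, and $[a,b)=\emptyset$ if $b\le a$.
   Formalization: The merging point α_k is taken as the least α in [0,1) where the two symbols' weights are equal and also equal the minimal weight w*_α; with equality alone the recursion fails for ties above the minimum, e.g. p=(2/5,2/5,1/5) gives α_1=1/6, α_2=0. *)

theory Defs
  imports "HOL-Analysis.Analysis"
begin

text \<open>
  The alphabet \<open>{x\<^sub>1, \<dots>, x\<^sub>n}\<close> is represented by its index set \<open>{1..n}\<close>. Probability vectors are
  functions on \<open>nat\<close> of which only the values on \<open>{1..n}\<close> matter. Length vectors are extensional
  functions on \<open>{1..n}\<close>, so that the minimizer of the pay-off is literally unique.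
\<close>

definition prob_vectors :: "nat \<Rightarrow> (nat \<Rightarrow> real) set" where
  "prob_vectors n = {p. antimono_on {1..n} p \<and> (\<forall>i\<in>{1..n}. p i > 0) \<and> (\<Sum>i=1..n. p i) = 1}"

definition code_lengths :: "nat \<Rightarrow> nat \<Rightarrow> (nat \<Rightarrow> real) set" where
  "code_lengths D n = {l \<in> {1..n} \<rightarrow>\<^sub>E {0..}. (\<Sum>i=1..n. real D powr (- l i)) \<le> 1}"

definition payoff :: "nat \<Rightarrow> real \<Rightarrow> (nat \<Rightarrow> real) \<Rightarrow> (nat \<Rightarrow> real) \<Rightarrow> real" where
  "payoff n \<alpha> l p = \<alpha> * Max (l ` {1..n}) + (1 - \<alpha>) * (\<Sum>i=1..n. l i * p i)"

text \<open>Existence and uniqueness of the minimizer are shown in \<open>ex1_opt_lengths\<close> below.\<close>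

definition opt_lengths :: "nat \<Rightarrow> nat \<Rightarrow> (nat \<Rightarrow> real) \<Rightarrow> real \<Rightarrow> nat \<Rightarrow> real" where
  "opt_lengths D n p \<alpha> =
     (THE l. is_arg_min (\<lambda>l. payoff n \<alpha> l p) (\<lambda>l. l \<in> code_lengths D n) l)"

definition opt_weight :: "nat \<Rightarrow> nat \<Rightarrow> (nat \<Rightarrow> real) \<Rightarrow> real \<Rightarrow> nat \<Rightarrow> real" where
  "opt_weight D n p \<alpha> i = real D powr (- opt_lengths D n p \<alpha> i)"

definition min_weight :: "nat \<Rightarrow> nat \<Rightarrow> (nat \<Rightarrow> real) \<Rightarrow> real \<Rightarrow> real" where
  "min_weight D n p \<alpha> = Min (opt_weight D n p \<alpha> ` {1..n})"

text \<open>
  The \<open>k\<close>-th merging point is the least \<open>\<alpha> \<in> [0,1)\<close> at which the weights of \<open>x\<^bsub>n-(k-1)\<^esub>\<close> and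
  \<open>x\<^bsub>n-k\<^esub>\<close> have merged, that is, coincide in the class of symbols of minimal weight. If these two
  symbols have different probabilities, then equality of their weights alone already forces
  both to be minimal, so the last clause is redundant (\<open>merge_point_eq_Least\<close> below). It matters
  only for two equiprobable symbols, whose weights agree from \<open>\<alpha> = 0\<close> on although
  neither need have joined the merged class: for the probabilities \<open>2/5, 2/5, 1/5\<close> the
  merging points must be \<open>\<alpha>\<^sub>1 = \<alpha>\<^sub>2 = 1/6\<close>, whereas equality of weights alone would give
  \<open>\<alpha>\<^sub>2 = 0 < \<alpha>\<^sub>1\<close>.
\<close>

definition merge_point :: "nat \<Rightarrow> nat \<Rightarrow> (nat \<Rightarrow> real) \<Rightarrow> nat \<Rightarrow> real" where
  "merge_point D n p k =
     (if k = 0 then 0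
      else if k = n then 1
      else (LEAST \<alpha>. \<alpha> \<in> {0..<1} \<and>
              opt_weight D n p \<alpha> (n - (k - 1)) = opt_weight D n p \<alpha> (n - k) \<and>
              opt_weight D n p \<alpha> (n - k) = min_weight D n p \<alpha>))"

definition merged_set :: "nat \<Rightarrow> nat \<Rightarrow> (nat \<Rightarrow> real) \<Rightarrow> nat \<Rightarrow> nat set" where
  "merged_set D n p k =
     {i \<in> {n - k..n}. opt_weight D n p (merge_point D n p k) i
                       = min_weight D n p (merge_point D n p k)}"

definition alpha_max :: "nat \<Rightarrow> nat \<Rightarrow> (nat \<Rightarrow> real) \<Rightarrow> real" where
  "alpha_max D n p =
     (LEAST a. a \<in> {0..1} \<and>
        (\<forall>\<alpha>\<in>{a..1}. \<forall>i\<in>{1..n}. \<forall>j\<in>{1..n}. opt_weight D n p \<alpha> i = opt_weight D n p \<alpha> j))"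


subsection \<open>The minimizer is well defined\<close>

lemma prob_vectors_pos: "p \<in> prob_vectors n \<Longrightarrow> 1 \<le> n"
  unfolding prob_vectors_def by (cases n) auto

lemma prob_le_1:
  assumes "p \<in> prob_vectors n" "i \<in> {1..n}"
  shows "p i \<le> 1"
proof -
  have "p i \<le> (\<Sum>i=1..n. p i)"
    using assms by (intro member_le_sum) (auto simp: prob_vectors_def less_imp_le)
  then show ?thesis using assms by (simp add: prob_vectors_def)
qed

lemma continuous_on_Max_image:
  fixes f :: "'b \<Rightarrow> 'a::topological_space \<Rightarrow> real"
  assumes "finite A" "A \<noteq> {}" "\<And>a. a \<in> A \<Longrightarrow> continuous_on S (f a)"
  shows "continuous_on S (\<lambda>x. Max ((\<lambda>a. f a x) ` A))"
  using assms
proof (induction A rule: finite_ne_induct)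
  case (singleton a)
  then show ?case by simp
next
  case (insert a A)
  then have "continuous_on S (\<lambda>x. max (f a x) (Max ((\<lambda>a. f a x) ` A)))"
    by (intro continuous_on_max) auto
  moreover have "(\<lambda>x. max (f a x) (Max ((\<lambda>a. f a x) ` A))) = (\<lambda>x. Max ((\<lambda>a. f a x) ` insert a A))"
    using insert by (auto simp: fun_eq_iff)
  ultimately show ?case by metis
qed

lemma ex_opt_lengths:
  assumes D: "2 \<le> D" and p: "p \<in> prob_vectors n" and a: "\<alpha> \<in> {0..1}"
  shows "\<exists>l. is_arg_min (\<lambda>l. payoff n \<alpha> l p) (\<lambda>l. l \<in> code_lengths D n) l"
proof -
  have n: "1 \<le> n" using prob_vectors_pos[OF p] .
  have ppos: "\<And>i. i \<in> {1..n} \<Longrightarrow> 0 < p i" and psum: "(\<Sum>i=1..n. p i) = 1"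
    and pmono: "\<And>i. i \<in> {1..n} \<Longrightarrow> p n \<le> p i"
    using p n by (auto simp: prob_vectors_def monotone_on_def)
  have pn: "0 < p n" "p n \<le> 1" using ppos[of n] prob_le_1[OF p, of n] n by auto
  define c where "c = log (real D) (real n)"
  define M where "M = c / p n"
  have c0: "0 \<le> c" unfolding c_def using n D by simp
  have cM: "c \<le> M" unfolding M_def using c0 pn
    by (simp add: pos_le_divide_eq mult_left_le)
  define u where "u = (\<lambda>i\<in>{1..n}. c)"
  have u: "u \<in> code_lengths D n"
  proof -
    have "(\<Sum>i=1..n. real D powr (- u i)) = (\<Sum>i=1..n. 1 / real n)"
      using n D by (intro sum.cong) (auto simp: u_def c_def powr_minus field_simps)
    then show ?thesis using c0 n by (auto simp: code_lengths_def u_def)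
  qed
  have umax: "u ` {1..n} = {c}" using n by (auto simp: u_def)
  have upay: "payoff n \<alpha> u p = c"
  proof -
    have "(\<Sum>i=1..n. u i * p i) = c * (\<Sum>i=1..n. p i)"
      unfolding sum_distrib_left by (rule sum.cong) (auto simp: u_def)
    then show ?thesis unfolding payoff_def umax psum by (simp add: algebra_simps)
  qed
  define K where "K = (\<lambda>i. if i \<in> {1..n} then {0..M} else {undefined::real})"
  define S where "S = PiE UNIV K \<inter> {l. (\<Sum>i=1..n. real D powr (- l i)) \<le> 1}"
  have S_sub: "S \<subseteq> code_lengths D n"
  proof
    fix l assume l: "l \<in> S"
    then have K: "\<And>i. l i \<in> K i" by (auto simp: S_def)
    have "l i \<ge> 0" if "i \<in> {1..n}" for i using K[of i] that by (simp add: K_def)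
    moreover have "l i = undefined" if "i \<notin> {1..n}" for i using K[of i] that by (auto simp: K_def)
    ultimately show "l \<in> code_lengths D n" using l by (auto simp: S_def code_lengths_def PiE_iff extensional_def)
  qed
  have in_S: "l \<in> S" if l: "l \<in> code_lengths D n" and le: "payoff n \<alpha> l p \<le> c" for l
  proof -
    have l0: "\<And>i. i \<in> {1..n} \<Longrightarrow> 0 \<le> l i" using l by (auto simp: code_lengths_def)
    have "l i \<le> M" if i: "i \<in> {1..n}" for i
    proof -
      have 1: "l i \<le> Max (l ` {1..n})" using i by auto
      have 2: "l i * p i \<le> (\<Sum>i=1..n. l i * p i)"
        using i by (intro member_le_sum) (auto simp: l0 ppos less_imp_le)
      have "l i * p n \<le> l i * p i" using pmono[OF i] l0[OF i] by (simp add: mult_left_mono)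
      then have 3: "l i * p n \<le> (\<Sum>i=1..n. l i * p i)" using 2 by simp
      have "l i * p n \<le> l i" using l0[OF i] pn by (simp add: mult_left_le)
      then have 4: "l i * p n \<le> Max (l ` {1..n})" using 1 by simp
      have "\<alpha> * (l i * p n) + (1 - \<alpha>) * (l i * p n) \<le> payoff n \<alpha> l p"
        unfolding payoff_def using 3 4 a by (intro add_mono mult_left_mono) auto
      then have "l i * p n \<le> c" using le by (simp add: algebra_simps)
      then show ?thesis unfolding M_def using pn by (simp add: pos_le_divide_eq)
    qed
    then show ?thesis using l l0 by (auto simp: S_def K_def code_lengths_def PiE_iff extensional_def)
  qed
  have "compactin (product_topology (\<lambda>i. euclidean) UNIV) (PiE UNIV K)"
    unfolding compactin_PiE by (auto simp: K_def)
  then have "compact (PiE UNIV K)"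
    using euclidean_product_topology[where 'a=nat and 'b=real] by simp
  moreover have "closed {l :: nat \<Rightarrow> real. (\<Sum>i=1..n. real D powr (- l i)) \<le> 1}"
    using D by (intro closed_Collect_le continuous_intros continuous_on_product_coordinates) auto
  ultimately have "compact S" unfolding S_def by (rule compact_Int_closed)
  moreover have uS: "u \<in> S" using in_S[OF u] upay by simp
  moreover have "continuous_on S (\<lambda>l. payoff n \<alpha> l p)"
  proof -
    have "continuous_on S (\<lambda>l::nat \<Rightarrow> real. Max ((\<lambda>i. l i) ` {1..n}))"
      using n by (intro continuous_on_Max_image continuous_on_subset[OF continuous_on_product_coordinates]) auto
    then show ?thesis unfolding payoff_def
      by (intro continuous_intros continuous_on_subset[OF continuous_on_product_coordinates]) auto
  qed
  ultimately obtain l where l: "l \<in> S" "\<And>l'. l' \<in> S \<Longrightarrow> payoff n \<alpha> l p \<le> payoff n \<alpha> l' p"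
    using continuous_attains_inf[of S "\<lambda>l. payoff n \<alpha> l p"] by blast
  have "payoff n \<alpha> l p \<le> payoff n \<alpha> l' p" if "l' \<in> code_lengths D n" for l'
    using l(2)[of l'] in_S[OF that] l(2)[OF uS] upay by fastforce
  then show ?thesis using l(1) S_sub by (auto simp: is_arg_min_linorder)
qed

lemma payoff_midpoint_le:
  assumes "1 \<le> n" "\<alpha> \<in> {0..1}" "\<And>i. i \<in> {1..n} \<Longrightarrow> m i = (l i + l' i) / 2"
  shows "payoff n \<alpha> m p \<le> (payoff n \<alpha> l p + payoff n \<alpha> l' p) / 2"
proof -
  have "m i \<le> (Max (l ` {1..n}) + Max (l' ` {1..n})) / 2" if i: "i \<in> {1..n}" for i
  proof -
    have "l i \<le> Max (l ` {1..n})" "l' i \<le> Max (l' ` {1..n})" using i by auto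
    then show ?thesis using assms(3)[OF i] by simp
  qed
  then have "Max (m ` {1..n}) \<le> (Max (l ` {1..n}) + Max (l' ` {1..n})) / 2"
    using assms(1) by (subst Max_le_iff) auto
  then have 1: "\<alpha> * Max (m ` {1..n}) \<le> \<alpha> * ((Max (l ` {1..n}) + Max (l' ` {1..n})) / 2)"
    using assms(2) by (intro mult_left_mono) auto
  have "(\<Sum>i=1..n. m i * p i) = (\<Sum>i=1..n. (l i * p i + l' i * p i) / 2)"
    by (rule sum.cong) (auto simp: assms(3) field_simps)
  also have "\<dots> = ((\<Sum>i=1..n. l i * p i) + (\<Sum>i=1..n. l' i * p i)) / 2"
    by (simp add: sum.distrib sum_divide_distrib [symmetric])
  finally have 2: "(\<Sum>i=1..n. m i * p i) = ((\<Sum>i=1..n. l i * p i) + (\<Sum>i=1..n. l' i * p i)) / 2" .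
  show ?thesis using 1 unfolding payoff_def 2 by (simp add: field_simps)
qed

lemma opt_lengths_unique:
  assumes D: "2 \<le> D" and p: "p \<in> prob_vectors n" and a: "\<alpha> \<in> {0..1}"
    and l: "is_arg_min (\<lambda>l. payoff n \<alpha> l p) (\<lambda>l. l \<in> code_lengths D n) l"
    and l': "is_arg_min (\<lambda>l. payoff n \<alpha> l p) (\<lambda>l. l \<in> code_lengths D n) l'"
  shows "l = l'"
proof (rule ccontr)
  assume ne: "l \<noteq> l'"
  have n: "1 \<le> n" using prob_vectors_pos[OF p] .
  have psum: "(\<Sum>i=1..n. p i) = 1" using p by (simp add: prob_vectors_def)
  let ?w = "\<lambda>t. real D powr (- t)"
  have lC: "l \<in> code_lengths D n" "l' \<in> code_lengths D n"
    and opt: "\<And>y. y \<in> code_lengths D n \<Longrightarrow> payoff n \<alpha> l p \<le> payoff n \<alpha> y p"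
    and eq: "payoff n \<alpha> l p = payoff n \<alpha> l' p"
    using l l' by (auto simp: is_arg_min_linorder intro: antisym)
  have "\<exists>j\<in>{1..n}. l j \<noteq> l' j"
  proof (rule ccontr)
    assume "\<not> ?thesis"
    then have "\<And>i. i \<in> {1..n} \<Longrightarrow> l i = l' i" by blast
    moreover have "l \<in> {1..n} \<rightarrow>\<^sub>E {0..}" "l' \<in> {1..n} \<rightarrow>\<^sub>E {0..}"
      using lC by (simp_all add: code_lengths_def)
    ultimately have "l = l'" by (meson PiE_ext)
    with ne show False ..
  qed
  then obtain j where j: "j \<in> {1..n}" "l j \<noteq> l' j" ..
  define m where "m = (\<lambda>i. (l i + l' i) / 2)"
  have half: "?w (m i) = ?w (l i / 2) * ?w (l' i / 2)" for i
    by (simp add: m_def powr_add [symmetric] add_divide_distrib)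
  have sq: "?w (l i) = (?w (l i / 2))\<^sup>2" "?w (l' i) = (?w (l' i / 2))\<^sup>2" for i
    by (simp_all add: power2_eq_square powr_add [symmetric])
  have diff: "(?w (l i) + ?w (l' i)) / 2 - ?w (m i) = (?w (l i / 2) - ?w (l' i / 2))\<^sup>2 / 2" for i
    unfolding half sq by (simp add: power2_eq_square field_simps)
  have le: "?w (m i) \<le> (?w (l i) + ?w (l' i)) / 2" for i
    using diff[of i] by (smt (verit) zero_le_power2 divide_nonneg_pos)
  have "?w (l j / 2) \<noteq> ?w (l' j / 2)" using j D by (simp add: powr_inj)
  then have lt: "?w (m j) < (?w (l j) + ?w (l' j)) / 2"
    using diff[of j] by (smt (verit) zero_less_power2 divide_pos_pos)
  have "(\<Sum>i=1..n. ?w (m i)) < (\<Sum>i=1..n. (?w (l i) + ?w (l' i)) / 2)"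
    using le lt j by (intro sum_strict_mono_ex1) auto
  also have "\<dots> = ((\<Sum>i=1..n. ?w (l i)) + (\<Sum>i=1..n. ?w (l' i))) / 2"
    by (simp add: sum.distrib sum_divide_distrib [symmetric])
  also have "\<dots> \<le> 1" using lC by (simp add: code_lengths_def)
  finally have k1: "(\<Sum>i=1..n. ?w (m i)) < 1" .
  define s where "s = (\<Sum>i=1..n. ?w (m i))"
  have wpos: "\<And>t. 0 < ?w t" using D by simp
  have s0: "0 < s" unfolding s_def using n wpos by (intro sum_pos) auto
  define e where "e = - log D s"
  have e0: "0 < e" unfolding e_def using k1 s0 D by (simp add: s_def)
  have em: "e \<le> m i" if i: "i \<in> {1..n}" for i
  proof -
    have "?w (m i) \<le> s" unfolding s_def using i wpos by (intro member_le_sum) (auto simp: less_imp_le)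
    then have "log D (?w (m i)) \<le> log D s" using D wpos s0 by (intro log_mono) auto
    then show ?thesis unfolding e_def using D by simp
  qed
  define y where "y = (\<lambda>i\<in>{1..n}. m i - e)"
  have "(\<Sum>i=1..n. ?w (y i)) = (\<Sum>i=1..n. ?w (m i) * D powr e)"
    by (rule sum.cong) (auto simp: y_def powr_add [symmetric])
  also have "\<dots> = s * D powr e" by (simp add: s_def sum_distrib_right)
  also have "\<dots> = 1" unfolding e_def using D s0 by (simp add: powr_minus)
  finally have y: "y \<in> code_lengths D n"
    using em by (auto simp: code_lengths_def y_def)
  have "Max (y ` {1..n}) \<le> Max (m ` {1..n}) - e"
    using n by (subst Max_le_iff) (auto simp: y_def)
  then have "\<alpha> * Max (y ` {1..n}) \<le> \<alpha> * (Max (m ` {1..n}) - e)"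
    using a by (intro mult_left_mono) auto
  moreover have y_sum: "(\<Sum>i=1..n. y i * p i) = (\<Sum>i=1..n. m i * p i) - e"
  proof -
    have "(\<Sum>i=1..n. y i * p i) = (\<Sum>i=1..n. m i * p i - e * p i)"
      by (rule sum.cong) (auto simp: y_def algebra_simps)
    also have "\<dots> = (\<Sum>i=1..n. m i * p i) - e * (\<Sum>i=1..n. p i)"
      by (simp add: sum_subtractf sum_distrib_left)
    finally show ?thesis using psum by simp
  qed
  ultimately have "payoff n \<alpha> y p \<le> payoff n \<alpha> m p - e"
    unfolding payoff_def y_sum right_diff_distrib by (simp add: left_diff_distrib)
  moreover have "payoff n \<alpha> m p \<le> payoff n \<alpha> l p"
    using payoff_midpoint_le[OF n a, of m l l' p] eq by (simp add: m_def)
  ultimately show False using opt[OF y] e0 by simp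
qed

theorem ex1_opt_lengths:
  assumes "2 \<le> D" "p \<in> prob_vectors n" "\<alpha> \<in> {0..1}"
  shows "\<exists>!l. is_arg_min (\<lambda>l. payoff n \<alpha> l p) (\<lambda>l. l \<in> code_lengths D n) l"
  using ex_opt_lengths[OF assms] opt_lengths_unique[OF assms] by blast

lemma is_arg_min_opt_lengths:
  assumes "2 \<le> D" "p \<in> prob_vectors n" "\<alpha> \<in> {0..1}"
  shows "is_arg_min (\<lambda>l. payoff n \<alpha> l p) (\<lambda>l. l \<in> code_lengths D n) (opt_lengths D n p \<alpha>)"
  unfolding opt_lengths_def using ex1_opt_lengths[OF assms] by (rule theI')


subsection \<open>Merging of symbols with different probabilities\<close>

lemma opt_eq_imp_max:
  assumes D: "2 \<le> D" and p: "p \<in> prob_vectors n" and a: "\<alpha> \<in> {0..<1}"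
    and l: "is_arg_min (\<lambda>l. payoff n \<alpha> l p) (\<lambda>l. l \<in> code_lengths D n) l"
    and i: "i \<in> {1..n}" and j: "j \<in> {1..n}" and pij: "p j < p i" and lij: "l i = l j"
    and m: "m \<in> {1..n}"
  shows "l m \<le> l i"
proof (rule ccontr)
  assume "\<not> ?thesis"
  then have gap: "l i < l m" by simp
  have ne: "i \<noteq> j" "m \<noteq> i" "m \<noteq> j" using pij gap lij by auto
  let ?w = "\<lambda>t. real D powr (- t)"
  have lC: "l \<in> code_lengths D n"
    and opt: "\<And>y. y \<in> code_lengths D n \<Longrightarrow> payoff n \<alpha> l p \<le> payoff n \<alpha> y p"
    using l by (auto simp: is_arg_min_linorder)
  have l0: "\<And>i. i \<in> {1..n} \<Longrightarrow> 0 \<le> l i" and kraft: "(\<Sum>i=1..n. ?w (l i)) \<le> 1"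
    using lC by (auto simp: code_lengths_def)
  have D1: "1 < real D" using D by simp
  have split: "(\<Sum>k=1..n. f k) = f i + f j + (\<Sum>k\<in>{1..n} - {i, j}. f k)" for f :: "nat \<Rightarrow> real"
  proof -
    have "(\<Sum>k=1..n. f k) = (\<Sum>k\<in>{i, j}. f k) + (\<Sum>k\<in>{1..n} - {i, j}. f k)"
      using i j by (subst sum.subset_diff[of "{i, j}"]) auto
    then show ?thesis using ne by simp
  qed
  have "?w (l i) + ?w (l j) \<le> 1"
    using kraft split[of "\<lambda>i. ?w (l i)"] sum_nonneg[of "{1..n} - {i, j}" "\<lambda>i. ?w (l i)"] by simp
  then have "2 * ?w (l i) \<le> 1" using lij by simp
  then have Dt: "2 \<le> real D powr l i" using D1 by (simp add: powr_minus field_simps)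
  define s where "s = min (1/4) (min ((p i - p j) / 4) (1 - ?w (l m - l i)))"
  have g1: "?w (l m - l i) < 1" using gap D1 by (simp add: powr_less_one)
  have s: "0 < s" "s \<le> 1/4" "s \<le> (p i - p j) / 4" "s \<le> 1 - ?w (l m - l i)"
    unfolding s_def using pij g1 by (simp, linarith, linarith, linarith)
  define A where "A = log D (1 + s)"
  define B where "B = - log D (1 - s)"
  have Ai: "A \<le> l i"
  proof -
    have "A \<le> log D (real D powr l i)" unfolding A_def using s Dt D1 by (intro log_mono) auto
    then show ?thesis using D1 by simp
  qed
  have A0: "0 < A" unfolding A_def using s D1 by simp
  have B0: "0 < B" unfolding B_def using s D1 by simp
  have Bm: "B \<le> l m - l i"
  proof -
    have "log D (?w (l m - l i)) \<le> log D (1 - s)" using s D1 by (intro log_mono) auto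
    then show ?thesis unfolding B_def using D1 by simp
  qed
  have wA: "?w (l i - A) = ?w (l i) * (1 + s)"
    unfolding A_def using s D1 by (simp add: powr_diff powr_minus field_simps)
  have wB: "?w (l j + B) = ?w (l j) * (1 - s)"
    unfolding B_def using s D1 by (simp add: powr_diff powr_minus field_simps)
  define y where "y = l(i := l i - A, j := l j + B)"
  have yo: "y k = l k" if "k \<notin> {i, j}" for k using that by (simp add: y_def)
  have yi: "y i = l i - A" "y j = l j + B" using ne by (auto simp: y_def)
  have "(\<Sum>k=1..n. ?w (y k)) = (\<Sum>k=1..n. ?w (l k))"
  proof -
    have "(\<Sum>k\<in>{1..n} - {i, j}. ?w (y k)) = (\<Sum>k\<in>{1..n} - {i, j}. ?w (l k))"
      by (rule sum.cong) (auto simp: yo)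
    then show ?thesis
      unfolding split[of "\<lambda>k. ?w (y k)"] split[of "\<lambda>k. ?w (l k)"] yi wA wB
      by (simp add: lij distrib_left right_diff_distrib)
  qed
  then have y_kraft: "(\<Sum>k=1..n. ?w (y k)) \<le> 1" using kraft by simp
  have "0 \<le> y k" if k: "k \<in> {1..n}" for k
  proof -
    consider "k = i" | "k = j" | "k \<notin> {i, j}" by blast
    then show ?thesis
    proof cases
      case 1
      then show ?thesis using Ai yi(1) by simp
    next
      case 2
      then show ?thesis using l0[OF j] B0 yi(2) by simp
    next
      case 3
      then show ?thesis using l0[OF k] yo by simp
    qed
  qed
  moreover have "y k = undefined" if k: "k \<notin> {1..n}" for k
  proof -
    have "l k = undefined" using lC k by (simp add: code_lengths_def PiE_iff extensional_def)
    moreover have "k \<notin> {i, j}" using i j k by blast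
    ultimately show ?thesis using yo by simp
  qed
  ultimately have "y \<in> {1..n} \<rightarrow>\<^sub>E {0..}" by (simp add: PiE_iff extensional_def)
  with y_kraft have y: "y \<in> code_lengths D n" by (simp add: code_lengths_def)
  have "y k \<le> Max (l ` {1..n})" if k: "k \<in> {1..n}" for k
  proof -
    have lM: "l k \<le> Max (l ` {1..n})" "l m \<le> Max (l ` {1..n})" using k m by auto
    consider "k = i" | "k = j" | "k \<notin> {i, j}" by blast
    then show ?thesis
    proof cases
      case 1
      then show ?thesis using lM(1) A0 yi(1) by simp
    next
      case 2
      then have "y k \<le> l m" using yi(2) Bm lij by simp
      then show ?thesis using lM(2) by (rule order_trans)
    next
      case 3
      then show ?thesis using lM(1) yo by simp
    qed
  qed
  then have "Max (y ` {1..n}) \<le> Max (l ` {1..n})" using i by (subst Max_le_iff) auto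
  then have 1: "\<alpha> * Max (y ` {1..n}) \<le> \<alpha> * Max (l ` {1..n})"
    using a by (intro mult_left_mono) auto
  have "(\<Sum>k\<in>{1..n} - {i, j}. y k * p k) = (\<Sum>k\<in>{1..n} - {i, j}. l k * p k)"
    by (rule sum.cong) (auto simp: yo)
  then have 2: "(\<Sum>k=1..n. y k * p k) = (\<Sum>k=1..n. l k * p k) - (p i * A - p j * B)"
    unfolding split[of "\<lambda>k. y k * p k"] split[of "\<lambda>k. l k * p k"] yi by (simp add: algebra_simps)
  have pp: "0 < p i" "0 < p j" "p i \<le> 1" "p j \<le> 1"
    using p i j prob_le_1[OF p] by (auto simp: prob_vectors_def)
  have "p i * ln (1 + s) \<ge> p i * (s - s\<^sup>2)"
    using ln_one_plus_pos_lower_bound[of s] s pp by (intro mult_left_mono) auto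
  moreover have "p j * (- ln (1 - s)) \<le> p j * (s + 2 * s\<^sup>2)"
    using ln_one_minus_pos_lower_bound[of s] s pp by (intro mult_left_mono) auto
  moreover have "p j * (s + 2 * s\<^sup>2) < p i * (s - s\<^sup>2)"
  proof -
    have "s * (p i + 2 * p j) \<le> s * 3" using pp s by (intro mult_left_mono) auto
    also have "s * 3 < p i - p j" using s(1,3) by simp
    finally have "s * (p i + 2 * p j) < p i - p j" .
    then have "s * (s * (p i + 2 * p j)) < s * (p i - p j)" using s by simp
    then show ?thesis by (simp add: algebra_simps power2_eq_square)
  qed
  ultimately have "0 < p i * ln (1 + s) - p j * (- ln (1 - s))" by linarith
  then have "0 < (p i * ln (1 + s) - p j * (- ln (1 - s))) / ln D" using D1 by simp
  also have "\<dots> = p i * A - p j * B" by (simp add: A_def B_def log_def field_simps add_divide_distrib)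
  finally have "0 < (1 - \<alpha>) * (p i * A - p j * B)" using a by simp
  then have "payoff n \<alpha> y p < payoff n \<alpha> l p"
    unfolding payoff_def 2 right_diff_distrib using 1 by simp
  then show False using opt[OF y] by simp
qed

theorem merge_point_eq_Least:
  assumes D: "2 \<le> D" and p: "p \<in> prob_vectors n"
    and k: "k \<in> {1..n - 1}" and pk: "p (n - (k - 1)) \<noteq> p (n - k)"
  shows "merge_point D n p k =
    (LEAST \<alpha>. \<alpha> \<in> {0..<1} \<and> opt_weight D n p \<alpha> (n - (k - 1)) = opt_weight D n p \<alpha> (n - k))"
proof -
  have ij: "n - k \<in> {1..n}" "n - (k - 1) \<in> {1..n}" using k by auto
  have lt: "p (n - (k - 1)) < p (n - k)"
    using p ij pk k by (auto simp: prob_vectors_def monotone_on_def order.strict_iff_order)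
  have "opt_weight D n p \<alpha> (n - k) = min_weight D n p \<alpha>"
    if a: "\<alpha> \<in> {0..<1}" and eq: "opt_weight D n p \<alpha> (n - (k - 1)) = opt_weight D n p \<alpha> (n - k)" for \<alpha>
  proof -
    let ?l = "opt_lengths D n p \<alpha>"
    have l: "is_arg_min (\<lambda>l. payoff n \<alpha> l p) (\<lambda>l. l \<in> code_lengths D n) ?l"
      using a by (intro is_arg_min_opt_lengths[OF D p]) auto
    have "?l (n - k) = ?l (n - (k - 1))" using eq D by (simp add: opt_weight_def powr_inj)
    then have "?l m \<le> ?l (n - k)" if "m \<in> {1..n}" for m
      using opt_eq_imp_max[OF D p a l ij lt _ that] by simp
    then have "opt_weight D n p \<alpha> (n - k) \<le> opt_weight D n p \<alpha> m" if "m \<in> {1..n}" for m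
      using that D by (simp add: opt_weight_def)
    then show ?thesis unfolding min_weight_def using ij by (intro Min_eqI [symmetric]) auto
  qed
  then show ?thesis using k unfolding merge_point_def by (auto intro!: arg_cong[where f = Least])
qed

end

theory Submission
  imports Defs
begin

text \<open>
  The optimal weights are given by water filling: \<open>w\<^sub>\<alpha>(x) = max ((1 - \<alpha>) p(x)) c\<close>, where the level
  \<open>c\<close> is chosen such that the weights sum to 1. Indeed \<open>w\<^sub>\<alpha> - (1 - \<alpha>) p\<close> is nonnegative, has total
  mass \<open>\<alpha>\<close> and lives on the symbols of minimal weight, so \<open>payoff l \<ge> \<Sum> w\<^sub>\<alpha> l\<close> for all lengths \<open>l\<close>, with
  equality for the lengths of \<open>w\<^sub>\<alpha>\<close> itself; Gibbs' inequality bounds the right-hand side.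

  Hence the symbol \<open>x\<^bsub>n-k\<^esub>\<close> lies on the level at \<open>\<alpha>\<close> iff \<open>(1 - \<alpha>) S\<^sub>k \<le> 1\<close> for
  \<open>S\<^sub>k = \<Sum>\<^sub>i max (p(x\<^sub>i)) (p(x\<^bsub>n-k\<^esub>))\<close>, which yields \<open>\<alpha>\<^sub>k = 1 - 1 / S\<^sub>k\<close> and \<open>\<U>\<^sub>k = {x\<^bsub>n-k\<^esub>, \<dots>, x\<^sub>n}\<close>.
  All claims follow from these closed forms.
\<close>

section \<open>Gibbs' inequality and elementary facts on sums and least elements\<close>

text \<open>Termwise this is \<open>ln t \<le> t - 1\<close> at \<open>t = v i / q i\<close>. The
  masses are compared by \<open>\<le>\<close> because the Kraft sum of a code may fall below
  1.\<close>

lemma gibbs_inequality: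
  fixes q v :: "'a \<Rightarrow> real"
  assumes "\<And>i. i \<in> A \<Longrightarrow> 0 < q i" "\<And>i. i \<in> A \<Longrightarrow> 0 < v i" "sum v A \<le> sum q A"
  shows "(\<Sum>i\<in>A. q i * ln (v i)) \<le> (\<Sum>i\<in>A. q i * ln (q i))"
proof -
  have "q i * ln (v i) - q i * ln (q i) \<le> v i - q i" if i: "i \<in> A" for i
  proof -
    have "q i * ln (v i / q i) \<le> q i * (v i / q i - 1)"
      using assms(1,2)[OF i] by (intro mult_left_mono ln_le_minus_one) auto
    then show ?thesis
      using assms(1,2)[OF i] by (simp add: ln_div right_diff_distrib)
  qed
  then have "(\<Sum>i\<in>A. q i * ln (v i) - q i * ln (q i)) \<le> (\<Sum>i\<in>A. v i - q i)"
    by (rule sum_mono)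
  then show ?thesis using assms(3) by (simp add: sum_subtractf)
qed

lemma sum_split_at:
  fixes f :: "nat \<Rightarrow> real"
  assumes "k < n"
  shows "(\<Sum>i=1..n. f i) = (\<Sum>i\<in>{1..<n - k}. f i) + (\<Sum>i=n - k..n. f i)"
  using assms by (subst sum.union_disjoint[symmetric]) (auto intro!: sum.cong)

text \<open>Merging points and \<open>alpha_max\<close> are both of this kind:
  \<open>(1 - a) * s \<le> 1\<close> says \<open>a \<ge> 1 - 1 / s\<close>, and \<open>R\<close>
  carries the upper bound on \<open>a\<close>. The bound \<open>1 \<le> s\<close> makes the
  threshold nonnegative.\<close>

lemma Least_scaled_le_1:
  fixes s :: real
  assumes "1 \<le> s" "\<And>a. Q a \<longleftrightarrow> 0 \<le> a \<and> (1 - a) * s \<le> 1 \<and> R a" "R (1 - 1 / s)"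
  shows "Least Q = 1 - 1 / s"
proof (rule Least_equality)
  show "Q (1 - 1 / s)" using assms by simp
  show "1 - 1 / s \<le> a" if "Q a" for a
  proof -
    have "1 - a \<le> 1 / s" using that assms(1,2) by (simp add: pos_le_divide_eq)
    then show ?thesis by simp
  qed
qed

context
  fixes D n :: nat and p :: "nat \<Rightarrow> real"
  assumes D: "2 \<le> D" and p: "p \<in> prob_vectors n"
begin

declare One_nat_def [simp del]

lemma n_pos: "1 \<le> n"
  using prob_vectors_pos[OF p] .

lemma p_pos: "i \<in> {1..n} \<Longrightarrow> 0 < p i"
  and p_sum: "(\<Sum>i=1..n. p i) = 1"
  and p_antimono: "i \<in> {1..n} \<Longrightarrow> j \<in> {1..n} \<Longrightarrow> i \<le> j \<Longrightarrow> p j \<le> p i"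
  using p by (auto simp: prob_vectors_def monotone_on_def)

section \<open>Optimal weights by water filling\<close>

text \<open>Any level \<open>c\<close> with these properties certifies a minimizer, and uniqueness
  of the minimizer then identifies the weights.\<close>

lemma opt_weight_water_filling:
  assumes a: "\<alpha> \<in> {0..1}" and c: "0 < c" "(1 - \<alpha>) * p n \<le> c"
    and total: "(\<Sum>i=1..n. max ((1 - \<alpha>) * p i) c) = 1" and i: "i \<in> {1..n}"
  shows "opt_weight D n p \<alpha> i = max ((1 - \<alpha>) * p i) c"
proof -
  define q where "q = (\<lambda>i. max ((1 - \<alpha>) * p i) c)"
  define l where "l = (\<lambda>i\<in>{1..n}. - log D (q i))"
  have D1: "1 < real D" using D by simp
  have q_pos: "0 < q i" for i using c(1) by (simp add: q_def)
  have q_sum: "(\<Sum>i=1..n. q i) = 1" using total by (simp add: q_def)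
  have q_le: "q i \<le> 1" if "i \<in> {1..n}" for i
    unfolding q_sum[symmetric] using that q_pos by (intro member_le_sum) (auto simp: less_imp_le)
  have w_l: "real D powr (- l i) = q i" if "i \<in> {1..n}" for i
    using that D1 q_pos by (simp add: l_def)
  have l_code: "l \<in> code_lengths D n"
  proof -
    have "(\<Sum>i=1..n. real D powr (- l i)) = 1"
      unfolding q_sum[symmetric] by (rule sum.cong) (auto simp: w_l)
    moreover have "0 \<le> l i" if "i \<in> {1..n}" for i
      using q_le[OF that] q_pos[of i] D1 that by (simp add: l_def)
    ultimately show ?thesis by (auto simp: code_lengths_def l_def)
  qed
  have l_Max: "Max (l ` {1..n}) = - log D c"
  proof (rule Max_eqI)
    \<comment> \<open>The least likely symbol lies on the level, so the bound
      \<open>- log D c\<close> on the lengths is attained.\<close>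
    have "q n = c" using c by (simp add: q_def)
    then show "- log D c \<in> l ` {1..n}" using n_pos by (auto simp: l_def intro!: image_eqI[of _ _ n])
    show "y \<le> - log D c" if "y \<in> l ` {1..n}" for y
      using that c(1) D1 by (auto simp: l_def q_def)
  qed simp
  have excess: "(\<Sum>i=1..n. q i - (1 - \<alpha>) * p i) = \<alpha>"
    by (simp add: sum_subtractf q_sum p_sum sum_distrib_left[symmetric])
  have split: "(\<Sum>i=1..n. q i * f i) =
      (\<Sum>i=1..n. (q i - (1 - \<alpha>) * p i) * f i) + (1 - \<alpha>) * (\<Sum>i=1..n. f i * p i)" for f
    by (simp add: sum_distrib_left sum.distrib[symmetric] algebra_simps)
  have l_payoff: "payoff n \<alpha> l p = (\<Sum>i=1..n. q i * l i)"
  proof -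
    have "(\<Sum>i=1..n. (q i - (1 - \<alpha>) * p i) * l i) = (\<Sum>i=1..n. (q i - (1 - \<alpha>) * p i) * - log D c)"
      by (rule sum.cong) (auto simp: l_def q_def max_def)
    also have "\<dots> = \<alpha> * - log D c"
      by (simp only: sum_distrib_right[symmetric] excess)
    finally show ?thesis unfolding payoff_def l_Max split by simp
  qed
  have payoff_ge: "(\<Sum>i=1..n. q i * y i) \<le> payoff n \<alpha> y p" for y
  proof -
    have "(\<Sum>i=1..n. (q i - (1 - \<alpha>) * p i) * y i)
        \<le> (\<Sum>i=1..n. (q i - (1 - \<alpha>) * p i) * Max (y ` {1..n}))"
      by (intro sum_mono mult_left_mono) (auto simp: q_def)
    also have "\<dots> = \<alpha> * Max (y ` {1..n})"
      by (simp only: sum_distrib_right[symmetric] excess)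
    finally show ?thesis unfolding payoff_def split by simp
  qed
  have "payoff n \<alpha> l p \<le> payoff n \<alpha> y p" if y: "y \<in> code_lengths D n" for y
  proof -
    \<comment> \<open>Kraft's inequality admits the weights of \<open>y\<close> to Gibbs'
      inequality. The logarithm of such a weight is \<open>- y i * ln D\<close>, so the inequality
      reverses for lengths.\<close>
    have "(\<Sum>i=1..n. real D powr (- y i)) \<le> (\<Sum>i=1..n. q i)"
      using y by (simp add: code_lengths_def q_sum)
    then have "(\<Sum>i=1..n. q i * ln (real D powr (- y i))) \<le> (\<Sum>i=1..n. q i * ln (q i))"
      using q_pos D1 by (intro gibbs_inequality) auto
    then have "(\<Sum>i=1..n. q i * ln (real D powr (- y i))) \<le> (\<Sum>i=1..n. q i * ln (real D powr (- l i)))"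
      by (simp add: w_l)
    then have "ln D * (\<Sum>i=1..n. q i * l i) \<le> ln D * (\<Sum>i=1..n. q i * y i)"
      using D1 by (simp add: ln_powr sum_negf sum_distrib_left algebra_simps)
    then have "(\<Sum>i=1..n. q i * l i) \<le> (\<Sum>i=1..n. q i * y i)"
      using D1 by simp
    then show ?thesis using payoff_ge[of y] by (simp add: l_payoff)
  qed
  then have "is_arg_min (\<lambda>l. payoff n \<alpha> l p) (\<lambda>l. l \<in> code_lengths D n) l"
    using l_code by (simp add: is_arg_min_linorder)
  then have "opt_lengths D n p \<alpha> = l"
    using opt_lengths_unique[OF D p a] is_arg_min_opt_lengths[OF D p a] by blast
  then show ?thesis using w_l[OF i] by (simp add: opt_weight_def q_def)
qed

lemma min_weight_water_filling:
  assumes "\<alpha> \<in> {0..1}" "0 < c" "(1 - \<alpha>) * p n \<le> c"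
    and "(\<Sum>i=1..n. max ((1 - \<alpha>) * p i) c) = 1"
  shows "min_weight D n p \<alpha> = c"
  unfolding min_weight_def
proof (rule Min_eqI)
  note w = opt_weight_water_filling[OF assms]
  show "c \<le> y" if "y \<in> opt_weight D n p \<alpha> ` {1..n}" for y
    using that w by auto
  show "c \<in> opt_weight D n p \<alpha> ` {1..n}"
    using w[of n] n_pos assms(3) by (auto intro!: image_eqI[of _ _ n])
qed simp

text \<open>Intermediate value theorem: the total mass is continuous in the level, equals
  \<open>1 - \<alpha>\<close> at level \<open>(1 - \<alpha>) * p n\<close> and is at least 1 at
  level 1.\<close>

lemma ex_water_level:
  assumes a: "\<alpha> \<in> {0..1}"
  obtains c where "0 < c" "(1 - \<alpha>) * p n \<le> c" "(\<Sum>i=1..n. max ((1 - \<alpha>) * p i) c) = 1"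
proof -
  define g where "g = (\<lambda>c. \<Sum>i=1..n. max ((1 - \<alpha>) * p i) c)"
  have np: "0 < p n" "p n \<le> 1" using p_pos[of n] prob_le_1[OF p, of n] n_pos by auto
  have an: "(1 - \<alpha>) * p n \<le> (1 - \<alpha>) * p i" if "i \<in> {1..n}" for i
    using p_antimono[of i n] that a by (intro mult_left_mono) auto
  have "g ((1 - \<alpha>) * p n) = (\<Sum>i=1..n. (1 - \<alpha>) * p i)"
    unfolding g_def using an by (intro sum.cong) auto
  then have lo: "g ((1 - \<alpha>) * p n) = 1 - \<alpha>"
    by (simp add: sum_distrib_left[symmetric] p_sum)
  have "(\<Sum>i=1..n. 1) \<le> g 1" unfolding g_def by (intro sum_mono) auto
  then have hi: "1 \<le> g 1" using n_pos by simp
  have "(1 - \<alpha>) * p n \<le> 1" using np a by (intro mult_le_one) auto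
  moreover have "continuous_on {(1 - \<alpha>) * p n..1} g"
    unfolding g_def by (intro continuous_intros)
  ultimately obtain c where c: "(1 - \<alpha>) * p n \<le> c" "g c = 1"
    using IVT'[of g "(1 - \<alpha>) * p n" 1 1] lo hi a by auto
  \<comment> \<open>Level 0 would force \<open>\<alpha> = 1\<close>, where the total mass at level 0
    is 0 instead of 1.\<close>
  have "0 < c"
  proof (rule ccontr)
    assume "\<not> 0 < c"
    moreover have "0 \<le> (1 - \<alpha>) * p n" using np a by simp
    ultimately have "(1 - \<alpha>) * p n = 0" "c = 0" using c(1) by linarith+
    then show False using np lo c(2) by auto
  qed
  with c that show thesis by (simp add: g_def)
qed

text \<open>The level just constructed is \<open>min_weight\<close>, which inherits its properties
  and serves as the level from here on.\<close>

lemma min_weight_pos: "\<alpha> \<in> {0..1} \<Longrightarrow> 0 < min_weight D n p \<alpha>"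
  and min_weight_ge: "\<alpha> \<in> {0..1} \<Longrightarrow> (1 - \<alpha>) * p n \<le> min_weight D n p \<alpha>"
  and min_weight_total: "\<alpha> \<in> {0..1} \<Longrightarrow> (\<Sum>i=1..n. max ((1 - \<alpha>) * p i) (min_weight D n p \<alpha>)) = 1"
  using ex_water_level min_weight_water_filling by metis+

lemma opt_weight_eq:
  "\<alpha> \<in> {0..1} \<Longrightarrow> i \<in> {1..n} \<Longrightarrow> opt_weight D n p \<alpha> i = max ((1 - \<alpha>) * p i) (min_weight D n p \<alpha>)"
  using opt_weight_water_filling min_weight_pos min_weight_ge min_weight_total by blast

section \<open>Merging points in closed form and merged sets\<close>

text \<open>The total mass increases with the level: it is 1 at level \<open>min_weight\<close>, and
  at level \<open>(1 - \<alpha>) * p j\<close> it is the quantity compared with 1 on the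
  right.\<close>

lemma le_min_weight_iff:
  assumes a: "\<alpha> \<in> {0..1}" and j: "j \<in> {1..n}"
  shows "(1 - \<alpha>) * p j \<le> min_weight D n p \<alpha> \<longleftrightarrow> (1 - \<alpha>) * (\<Sum>i=1..n. max (p i) (p j)) \<le> 1"
proof -
  let ?m = "min_weight D n p \<alpha>"
  have eq: "(1 - \<alpha>) * (\<Sum>i=1..n. max (p i) (p j)) = (\<Sum>i=1..n. max ((1 - \<alpha>) * p i) ((1 - \<alpha>) * p j))"
    using a by (simp add: sum_distrib_left max_mult_distrib_left)
  show ?thesis
  proof
    assume "(1 - \<alpha>) * p j \<le> ?m"
    then have "(\<Sum>i=1..n. max ((1 - \<alpha>) * p i) ((1 - \<alpha>) * p j)) \<le> (\<Sum>i=1..n. max ((1 - \<alpha>) * p i) ?m)"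
      by (intro sum_mono) auto
    then show "(1 - \<alpha>) * (\<Sum>i=1..n. max (p i) (p j)) \<le> 1"
      unfolding eq min_weight_total[OF a] .
  next
    assume le: "(1 - \<alpha>) * (\<Sum>i=1..n. max (p i) (p j)) \<le> 1"
    show "(1 - \<alpha>) * p j \<le> ?m"
    proof (rule ccontr)
      assume gt: "\<not> ?thesis"
      \<comment> \<open>Strictness comes from symbol \<open>n\<close>: it already lies on the level
        \<open>?m\<close>, so its weight rises with the level.\<close>
      have "max ((1 - \<alpha>) * p n) ?m < max ((1 - \<alpha>) * p n) ((1 - \<alpha>) * p j)"
        using gt min_weight_ge[OF a] by linarith
      then have "(\<Sum>i=1..n. max ((1 - \<alpha>) * p i) ?m) < (\<Sum>i=1..n. max ((1 - \<alpha>) * p i) ((1 - \<alpha>) * p j))"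
        using gt n_pos by (intro sum_strict_mono_ex1) (auto intro!: bexI[of _ n])
      then show False using le unfolding eq min_weight_total[OF a] by simp
    qed
  qed
qed

text \<open>As \<open>p\<close> is antitone, the \<open>k + 1\<close> symbols from
  \<open>n - k\<close> on are raised to \<open>p (n - k)\<close> and the earlier ones keep their
  probability.\<close>

lemma sum_max_eq:
  assumes "k < n"
  shows "(\<Sum>i=1..n. max (p i) (p (n - k))) = (\<Sum>i\<in>{1..<n - k}. p i) + (real k + 1) * p (n - k)"
proof -
  have "(\<Sum>i\<in>{1..<n - k}. max (p i) (p (n - k))) = (\<Sum>i\<in>{1..<n - k}. p i)"
    using assms by (intro sum.cong max_absorb1 p_antimono) auto
  moreover have "(\<Sum>i=n - k..n. max (p i) (p (n - k))) = (\<Sum>i=n - k..n. p (n - k))"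
    using assms by (intro sum.cong max_absorb2 p_antimono) auto
  ultimately show ?thesis using assms by (simp add: sum_split_at[OF assms])
qed

lemma sum_max_ge_1: "1 \<le> (\<Sum>i=1..n. max (p i) c)"
  unfolding p_sum[symmetric] by (intro sum_mono) auto

lemma merge_point_closed_form:
  assumes k: "k < n"
  shows "merge_point D n p k = 1 - 1 / (\<Sum>i=1..n. max (p i) (p (n - k)))"
proof (cases "k = 0")
  case True
  \<comment> \<open>Symbol \<open>n\<close> is least likely, so the formula yields 0, in agreement
    with the convention for \<open>k = 0\<close>.\<close>
  have "(\<Sum>i=1..n. max (p i) (p n)) = (\<Sum>i=1..n. p i)"
    using p_antimono n_pos by (intro sum.cong) (auto simp: max_def intro: antisym)
  then show ?thesis using True by (simp add: merge_point_def p_sum)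
next
  case False
  let ?s = "\<Sum>i=1..n. max (p i) (p (n - k))"
  have s1: "1 \<le> ?s" by (rule sum_max_ge_1)
  have ij: "n - k \<in> {1..n}" "n - (k - 1) \<in> {1..n}" using k False by auto
  \<comment> \<open>Once symbol \<open>n - k\<close> is on the level, so is its successor
    \<open>n - (k - 1)\<close>. Hence minimality of the weight of \<open>n - k\<close> implies that
    the two weights agree.\<close>
  have "p (n - (k - 1)) \<le> p (n - k)" using ij by (intro p_antimono) auto
  then have mono: "(1 - \<alpha>) * p (n - (k - 1)) \<le> c"
    if "\<alpha> \<in> {0..<1}" "(1 - \<alpha>) * p (n - k) \<le> c" for \<alpha> c
    using that by (intro order_trans[OF mult_left_mono that(2)]) auto
  have "(LEAST \<alpha>. \<alpha> \<in> {0..<1} \<and> opt_weight D n p \<alpha> (n - (k - 1)) = opt_weight D n p \<alpha> (n - k) \<and>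
          opt_weight D n p \<alpha> (n - k) = min_weight D n p \<alpha>) = 1 - 1 / ?s"
  proof (rule Least_scaled_le_1[OF s1])
    show "\<alpha> \<in> {0..<1} \<and> opt_weight D n p \<alpha> (n - (k - 1)) = opt_weight D n p \<alpha> (n - k) \<and>
          opt_weight D n p \<alpha> (n - k) = min_weight D n p \<alpha> \<longleftrightarrow>
          0 \<le> \<alpha> \<and> (1 - \<alpha>) * ?s \<le> 1 \<and> \<alpha> < 1" for \<alpha>
    proof (cases "\<alpha> \<in> {0..<1}")
      case True
      then have "\<alpha> \<in> {0..1}" by simp
      then show ?thesis
        using True ij mono[OF True] le_min_weight_iff[OF _ ij(1), of \<alpha>]
        by (auto simp: opt_weight_eq max_def)
    qed auto
    show "1 - 1 / ?s < 1" using s1 by simp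
  qed
  then show ?thesis using k False by (simp add: merge_point_def)
qed

lemma merge_point_bounds: "k < n \<Longrightarrow> merge_point D n p k \<in> {0..<1}"
  using sum_max_ge_1[of "p (n - k)"] by (simp add: merge_point_closed_form)

text \<open>Used at both ends of the interval between merging points: the left end puts symbol
  \<open>n - k\<close> on the level, the right end keeps symbol \<open>n - (k + 1)\<close> above
  it.\<close>

lemma le_min_weight_iff_merge_point:
  assumes "\<alpha> \<in> {0..1}" "k < n"
  shows "(1 - \<alpha>) * p (n - k) \<le> min_weight D n p \<alpha> \<longleftrightarrow> merge_point D n p k \<le> \<alpha>"
proof -
  let ?s = "\<Sum>i=1..n. max (p i) (p (n - k))"
  have "(1 - \<alpha>) * p (n - k) \<le> min_weight D n p \<alpha> \<longleftrightarrow> (1 - \<alpha>) * ?s \<le> 1"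
    using assms by (intro le_min_weight_iff) auto
  also have "\<dots> \<longleftrightarrow> 1 - \<alpha> \<le> 1 / ?s"
    using sum_max_ge_1[of "p (n - k)"] by (intro pos_le_divide_eq[symmetric]) linarith
  finally show ?thesis using assms by (auto simp: merge_point_closed_form)
qed

text \<open>By the closed form, the candidate level \<open>(1 - \<alpha>) * p (n - k)\<close> gives
  total mass exactly 1 at the merging point.\<close>

lemma min_weight_merge_point:
  assumes k: "k < n"
  shows "min_weight D n p (merge_point D n p k) = (1 - merge_point D n p k) * p (n - k)"
proof (rule min_weight_water_filling)
  let ?a = "merge_point D n p k" and ?s = "\<Sum>i=1..n. max (p i) (p (n - k))"
  have a: "?a \<in> {0..<1}" using merge_point_bounds[OF k] .
  then show "?a \<in> {0..1}" by simp
  show "0 < (1 - ?a) * p (n - k)" using a p_pos[of "n - k"] k by simp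
  show "(1 - ?a) * p n \<le> (1 - ?a) * p (n - k)"
    using a k by (intro mult_left_mono p_antimono) auto
  have "(\<Sum>i=1..n. max ((1 - ?a) * p i) ((1 - ?a) * p (n - k))) = (1 - ?a) * ?s"
    using a by (simp add: sum_distrib_left max_mult_distrib_left)
  also have "\<dots> = 1" using sum_max_ge_1[of "p (n - k)"] by (simp add: merge_point_closed_form[OF k])
  finally show "(\<Sum>i=1..n. max ((1 - ?a) * p i) ((1 - ?a) * p (n - k))) = 1" .
qed

text \<open>If \<open>p (n - (k + 1)) = p (n - k)\<close>, symbol \<open>n - (k + 1)\<close> has
  minimal weight as well; the index range in the definition of \<open>merged_set\<close> excludes
  it.\<close>

lemma merged_set_eq:
  assumes k: "k < n"
  shows "merged_set D n p k = {n - k..n}"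
proof -
  let ?a = "merge_point D n p k"
  have a: "?a \<in> {0..1}" using merge_point_bounds[OF k] by simp
  have "opt_weight D n p ?a i = min_weight D n p ?a" if i: "i \<in> {n - k..n}" for i
  proof -
    have "(1 - ?a) * p i \<le> (1 - ?a) * p (n - k)"
      using a i k by (intro mult_left_mono p_antimono) auto
    moreover have "i \<in> {1..n}" using i k by auto
    ultimately show ?thesis using k a by (simp add: opt_weight_eq min_weight_merge_point)
  qed
  then show ?thesis by (auto simp: merged_set_def)
qed

lemma compl_merged_set_eq: "k < n \<Longrightarrow> {1..n} - merged_set D n p k = {1..<n - k}"
  by (auto simp: merged_set_eq)

lemma card_merged_set: "k < n \<Longrightarrow> card (merged_set D n p k) = k + 1"
  by (simp add: merged_set_eq)

section \<open>Weights between merging points and the recursion\<close>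

text \<open>The weights sum to 1 at \<alpha> and at the merging point. Both balances involve the
  same unmerged mass, and their difference shows that the common level of the \<open>k + 1\<close>
  merged symbols is affine in \<alpha>.\<close>

lemma opt_weight_between_merge_points:
  assumes k: "k < n" and a: "\<alpha> \<in> {merge_point D n p k ..< merge_point D n p (k + 1)}"
  shows "i \<in> {1..<n - k} \<Longrightarrow> opt_weight D n p \<alpha> i = (1 - \<alpha>) * p i"
    and "i \<in> {n - k..n} \<Longrightarrow> opt_weight D n p \<alpha> i = min_weight D n p (merge_point D n p k) +
           (\<alpha> - merge_point D n p k) * ((\<Sum>j\<in>{1..<n - k}. p j) / (real k + 1))"
proof -
  let ?a = "merge_point D n p k" and ?P = "\<Sum>j\<in>{1..<n - k}. p j"
    and ?m = "min_weight D n p"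
  have a0: "?a \<in> {0..<1}" using merge_point_bounds[OF k] .
  \<comment> \<open>For \<open>k + 1 = n\<close> the endpoint is 1 by convention.\<close>
  have "merge_point D n p (k + 1) \<le> 1"
    using merge_point_bounds[of "k + 1"] k
    by (cases "k + 1 = n") (auto simp: merge_point_def[of D n p n])
  then have a1: "\<alpha> \<in> {0..1}" using a a0 by auto
  have top: "opt_weight D n p \<alpha> i = ?m \<alpha>" if "i \<in> {n - k..n}" for i
  proof -
    have "(1 - \<alpha>) * p i \<le> (1 - \<alpha>) * p (n - k)"
      using a1 that k by (intro mult_left_mono p_antimono) auto
    also have "\<dots> \<le> ?m \<alpha>" using le_min_weight_iff_merge_point[OF a1 k] a by simp
    finally have "(1 - \<alpha>) * p i \<le> ?m \<alpha>" .
    moreover have "i \<in> {1..n}" using that k by auto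
    ultimately show ?thesis using a1 by (simp add: opt_weight_eq)
  qed
  show low: "opt_weight D n p \<alpha> i = (1 - \<alpha>) * p i" if i: "i \<in> {1..<n - k}" for i
  proof -
    \<comment> \<open>An unmerged symbol exists only in this case, so the right endpoint is a
      genuine merging point.\<close>
    have k1: "k + 1 < n" using i by auto
    have "?m \<alpha> < (1 - \<alpha>) * p (n - (k + 1))"
      using le_min_weight_iff_merge_point[OF a1 k1] a by auto
    also have "\<dots> \<le> (1 - \<alpha>) * p i"
      using a1 i k1 by (intro mult_left_mono p_antimono) auto
    finally have "?m \<alpha> < (1 - \<alpha>) * p i" .
    moreover have "i \<in> {1..n}" using i by auto
    ultimately show ?thesis using a1 by (simp add: opt_weight_eq)
  qed
  have "1 = (\<Sum>i=1..n. opt_weight D n p \<alpha> i)"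
    using min_weight_total[OF a1] a1 by (simp add: opt_weight_eq)
  also have "\<dots> = (1 - \<alpha>) * ?P + (real k + 1) * ?m \<alpha>"
    using k by (simp add: sum_split_at[OF k] low top sum_distrib_left)
  finally have t1: "(1 - \<alpha>) * ?P + (real k + 1) * ?m \<alpha> = 1" by simp
  \<comment> \<open>The balance at the merging point is read off from its closed form.\<close>
  have "(1 - ?a) * (?P + (real k + 1) * p (n - k)) = 1"
    using sum_max_ge_1[of "p (n - k)"]
    by (simp add: merge_point_closed_form[OF k] sum_max_eq[OF k, symmetric] del: sum.op_ivl_Suc)
  then have t0: "(1 - ?a) * ?P + (real k + 1) * ?m ?a = 1"
    by (simp add: min_weight_merge_point[OF k] algebra_simps)
  have "(real k + 1) * ?m \<alpha> = (real k + 1) * ?m ?a + (\<alpha> - ?a) * ?P"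
    using t0 t1 by (simp add: algebra_simps)
  then have "?m \<alpha> = ?m ?a + (\<alpha> - ?a) * (?P / (real k + 1))"
    by (simp add: field_simps)
  then show "opt_weight D n p \<alpha> i = ?m ?a + (\<alpha> - ?a) * (?P / (real k + 1))"
    if "i \<in> {n - k..n}" using top[OF that] by simp
qed

lemma merge_point_Suc:
  assumes k: "k + 2 \<le> n"
  shows "merge_point D n p (k + 1) = merge_point D n p k + (1 - merge_point D n p k) *
    ((p (n - (k + 1)) - p (n - k)) / ((\<Sum>j\<in>{1..<n - k}. p j) / (real k + 1) + p (n - (k + 1))))"
proof -
  let ?P = "\<Sum>j\<in>{1..<n - k}. p j" and ?x = "p (n - (k + 1))" and ?y = "p (n - k)"
  define K where "K = real k + 1"
  have kn: "k < n" "k + 1 < n" using k by auto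
  have K: "0 < K" by (simp add: K_def)
  \<comment> \<open>One of the \<open>k + 2\<close> copies of \<open>?x\<close> is counted in
    \<open>?P\<close>. So the sums for \<open>k + 1\<close> and \<open>k\<close> have the same shape
    and differ by \<open>K * (?x - ?y)\<close>.\<close>
  have "{1..<n - k} = insert (n - (k + 1)) {1..<n - (k + 1)}" using k by auto
  then have "?P = (\<Sum>j\<in>{1..<n - (k + 1)}. p j) + ?x" by simp
  then have S1: "(\<Sum>i=1..n. max (p i) ?x) = ?P + K * ?x"
    using sum_max_eq[OF kn(2)] by (simp add: K_def algebra_simps)
  have S0: "(\<Sum>i=1..n. max (p i) ?y) = ?P + K * ?y"
    using sum_max_eq[OF kn(1)] by (simp add: K_def)
  have pos: "0 < ?P + K * ?x" "0 < ?P + K * ?y"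
    using sum_max_ge_1[of ?x] sum_max_ge_1[of ?y] unfolding S0 S1 by auto
  have "?P / K + ?x = (?P + K * ?x) / K" using K by (simp add: field_simps)
  then have quot: "(?x - ?y) / (?P / K + ?x) = ((?P + K * ?x) - (?P + K * ?y)) / (?P + K * ?x)"
    by (simp add: algebra_simps)
  \<comment> \<open>Here \<open>s\<close> and \<open>t\<close> stand for the sums of maxima
    belonging to \<open>k + 1\<close> and \<open>k\<close>.\<close>
  have eq: "1 - 1 / s = 1 - 1 / t + (1 - (1 - 1 / t)) * ((s - t) / s)"
    if "0 < s" "0 < t" for s t :: real
    using that by (simp add: field_simps)
  show ?thesis
    unfolding merge_point_closed_form[OF kn(1)] merge_point_closed_form[OF kn(2)] S0 S1 K_def[symmetric] quot
    by (rule eq[OF pos])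
qed

section \<open>The threshold of no compression\<close>

text \<open>Symbol \<open>n\<close> always lies on the level, so all weights agree iff the most
  likely symbol lies on it too; the sum of maxima for that symbol is \<open>n * p 1\<close>.\<close>

lemma alpha_max_eq: "alpha_max D n p = 1 - 1 / (real n * p 1)"
proof -
  have one: "1 \<in> {1..n}" using n_pos by simp
  have "(\<Sum>i=1..n. max (p i) (p 1)) = (\<Sum>i=1..n. p 1)"
    using p_antimono n_pos by (intro sum.cong) (auto simp: max_def intro: antisym)
  then have S: "(\<Sum>i=1..n. max (p i) (p 1)) = real n * p 1" by simp
  have s1: "1 \<le> real n * p 1" using sum_max_ge_1[of "p 1"] unfolding S .
  have flat: "(\<forall>i\<in>{1..n}. \<forall>j\<in>{1..n}. opt_weight D n p \<alpha> i = opt_weight D n p \<alpha> j) \<longleftrightarrow>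
      (1 - \<alpha>) * (real n * p 1) \<le> 1" if a: "\<alpha> \<in> {0..1}" for \<alpha>
  proof -
    let ?m = "min_weight D n p \<alpha>"
    have "(\<forall>i\<in>{1..n}. \<forall>j\<in>{1..n}. opt_weight D n p \<alpha> i = opt_weight D n p \<alpha> j) \<longleftrightarrow>
        (1 - \<alpha>) * p 1 \<le> ?m"
    proof
      assume "\<forall>i\<in>{1..n}. \<forall>j\<in>{1..n}. opt_weight D n p \<alpha> i = opt_weight D n p \<alpha> j"
      then have "opt_weight D n p \<alpha> 1 = opt_weight D n p \<alpha> n" using n_pos by simp
      then show "(1 - \<alpha>) * p 1 \<le> ?m"
        using a n_pos min_weight_ge[OF a] by (simp add: opt_weight_eq)
    next
      assume le: "(1 - \<alpha>) * p 1 \<le> ?m"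
      have "opt_weight D n p \<alpha> i = ?m" if i: "i \<in> {1..n}" for i
      proof -
        have "(1 - \<alpha>) * p i \<le> (1 - \<alpha>) * p 1"
          using a i one by (intro mult_left_mono p_antimono) auto
        then show ?thesis using a i le by (simp add: opt_weight_eq)
      qed
      then show "\<forall>i\<in>{1..n}. \<forall>j\<in>{1..n}. opt_weight D n p \<alpha> i = opt_weight D n p \<alpha> j" by simp
    qed
    then show ?thesis using le_min_weight_iff[OF a one] unfolding S by simp
  qed
  \<comment> \<open>Weights that agree at \<open>a\<close> still agree for larger \<alpha>, so the
    condition on all of \<open>{a..1}\<close> reduces to the one at \<open>a\<close>.\<close>
  have mono: "(1 - \<alpha>) * (real n * p 1) \<le> (1 - a) * (real n * p 1)" if "a \<le> \<alpha>" for a \<alpha>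
    using that s1 by (intro mult_right_mono) auto
  show ?thesis
    unfolding alpha_max_def
  proof (rule Least_scaled_le_1[OF s1, where R = "\<lambda>a. a \<le> 1"])
    fix a :: real
    show "a \<in> {0..1} \<and> (\<forall>\<alpha>\<in>{a..1}. \<forall>i\<in>{1..n}. \<forall>j\<in>{1..n}. opt_weight D n p \<alpha> i = opt_weight D n p \<alpha> j)
        \<longleftrightarrow> 0 \<le> a \<and> (1 - a) * (real n * p 1) \<le> 1 \<and> a \<le> 1"
    proof (cases "a \<in> {0..1}")
      case True
      then have "(\<forall>\<alpha>\<in>{a..1}. \<forall>i\<in>{1..n}. \<forall>j\<in>{1..n}. opt_weight D n p \<alpha> i = opt_weight D n p \<alpha> j) \<longleftrightarrow>
          (\<forall>\<alpha>\<in>{a..1}. (1 - \<alpha>) * (real n * p 1) \<le> 1)"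
        by (intro ball_cong flat) auto
      also have "\<dots> \<longleftrightarrow> (1 - a) * (real n * p 1) \<le> 1"
        using True mono by (meson atLeastAtMost_iff order.refl order_trans)
      finally show ?thesis using True by simp
    qed auto
    show "1 - 1 / (real n * p 1) \<le> 1" using s1 by simp
  qed
qed

end

theorem theorem1:
  fixes D n :: nat and p :: "nat \<Rightarrow> real"
  assumes "2 \<le> D" and "p \<in> prob_vectors n"
  shows
    "(\<forall>k<n. \<forall>\<alpha>\<in>{merge_point D n p k ..< merge_point D n p (k + 1)}.
        (\<forall>i \<in> {1..n} - merged_set D n p k. opt_weight D n p \<alpha> i = (1 - \<alpha>) * p i) \<and>
        (\<forall>i \<in> merged_set D n p k. opt_weight D n p \<alpha> i =
           min_weight D n p (merge_point D n p k) +
           (\<alpha> - merge_point D n p k) *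
             ((\<Sum>j \<in> {1..n} - merged_set D n p k. p j) / real (card (merged_set D n p k)))))
     \<and> (\<forall>k. k + 2 \<le> n \<longrightarrow>
        merge_point D n p (k + 1) =
          merge_point D n p k +
          (1 - merge_point D n p k) *
            ((p (n - (k + 1)) - p (n - k)) /
             ((\<Sum>j \<in> {1..n} - merged_set D n p k. p j) / real (card (merged_set D n p k))
              + p (n - (k + 1)))))
     \<and> alpha_max D n p = 1 - 1 / (real n * p 1)"
proof (intro conjI allI impI ballI)
  fix k \<alpha> i
  assume k: "k < n" and a: "\<alpha> \<in> {merge_point D n p k ..< merge_point D n p (k + 1)}"
  show "opt_weight D n p \<alpha> i = (1 - \<alpha>) * p i" if "i \<in> {1..n} - merged_set D n p k"
    using that opt_weight_between_merge_points(1)[OF assms k a] unfolding compl_merged_set_eq[OF assms k] by blast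
  show "opt_weight D n p \<alpha> i = min_weight D n p (merge_point D n p k) +
      (\<alpha> - merge_point D n p k) *
        ((\<Sum>j \<in> {1..n} - merged_set D n p k. p j) / real (card (merged_set D n p k)))"
    if "i \<in> merged_set D n p k"
    using opt_weight_between_merge_points(2)[OF assms k a] that[unfolded merged_set_eq[OF assms k]]
    unfolding compl_merged_set_eq[OF assms k] card_merged_set[OF assms k] by (simp add: add.commute)
next
  fix k assume k: "k + 2 \<le> n"
  then have kn: "k < n" by simp
  show "merge_point D n p (k + 1) = merge_point D n p k + (1 - merge_point D n p k) *
      ((p (n - (k + 1)) - p (n - k)) /
       ((\<Sum>j \<in> {1..n} - merged_set D n p k. p j) / real (card (merged_set D n p k))
        + p (n - (k + 1))))"
    using merge_point_Suc[OF assms k]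
    unfolding compl_merged_set_eq[OF assms kn] card_merged_set[OF assms kn] by (simp add: add.commute)
next
  show "alpha_max D n p = 1 - 1 / (real n * p 1)"
    by (rule alpha_max_eq[OF assms])
qed

end
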